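(* Let $h_{-}$ and $h_{+}$ be two convex functions from a locally convex real space $\mathcal{X}$ to $(-\infty,\infty]$ such that $h_{-}$ is lower semi-continuous and $h_{+}$ is upper semi-continuous. Let $h:=h_{-}+h_{+}$ and let $K\subset\mathcal{X}$ be a non-empty compact convex subset. Then the supremum of $h$ over $K$ can be reduced to the (non-empty) set $\mathcal{E}(K)$ of extreme points of $K$, i.e. $$\sup h(K)=\sup h(\mathcal{E}(K)).$$
   Context: Topological vector spaces are assumed to be Hausdorff; a locally convex real space is a real, Hausdorff, locally convex topological vector space. For a set $S\subset\mathcal{X}$, $\sup h(S):=\sup_{x\in S}h(x)$. *)

theory Defs
  imports "HOL-Analysis.Analysis"
begin

text \<open>
  Hausdorff, locally convex real topological vector spaces. Joint continuity of addition and
  continuity of negation come from \<^class>\<open>topological_ab_group_add\<close>. The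
  specification unfolds \<^const>\<open>convex\<close>, whose sort constraint prevents its use
  inside a class specification; the lemma below folds it again.
\<close>

class locally_convex_space = real_vector + topological_ab_group_add + t2_space +
  assumes tendsto_scaleR_Pair:
      "LIM p (nhds c \<times>\<^sub>F nhds a). fst p *\<^sub>R snd p :> nhds (c *\<^sub>R a)"
    and convex_nhds_zero_unfolded:
      "open U \<Longrightarrow> 0 \<in> U \<Longrightarrow>
        \<exists>V. (\<forall>x\<in>V. \<forall>y\<in>V. \<forall>u\<ge>0. \<forall>v\<ge>0. u + v = 1 \<longrightarrow> u *\<^sub>R x + v *\<^sub>R y \<in> V) \<and>
          (\<forall>\<^sub>F x in nhds 0. x \<in> V) \<and> V \<subseteq> U"

lemma convex_nhds_zero:
  fixes U :: "'a::locally_convex_space set"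
  assumes "open U" "0 \<in> U"
  shows "\<exists>V. convex V \<and> (\<forall>\<^sub>F x in nhds 0. x \<in> V) \<and> V \<subseteq> U"
  using convex_nhds_zero_unfolded[OF assms] unfolding convex_def .

instance real_normed_vector \<subseteq> locally_convex_space
proof
  fix c :: real and a :: 'a
  show "LIM p (nhds c \<times>\<^sub>F nhds a). fst p *\<^sub>R snd p :> nhds (c *\<^sub>R a)"
    by (intro tendsto_scaleR filterlim_fst filterlim_snd)
next
  fix U :: "'a set"
  assume "open U" "0 \<in> U"
  then obtain e where e: "e > 0" "ball 0 e \<subseteq> U"
    by (meson openE)
  have "convex (ball (0::'a) e)" "\<forall>\<^sub>F x in nhds 0. x \<in> ball (0::'a) e"
    using e eventually_nhds_in_open[of "ball 0 e" "0::'a"] by (simp_all del: mem_ball)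
  then show "\<exists>V. (\<forall>x\<in>V. \<forall>y\<in>V. \<forall>u\<ge>0. \<forall>v\<ge>0. u + v = 1 \<longrightarrow> u *\<^sub>R x + v *\<^sub>R y \<in> V) \<and>
      (\<forall>\<^sub>F x in nhds 0. x \<in> V) \<and> V \<subseteq> U"
    using e unfolding convex_def by blast
qed

text \<open>
  The library's \<^const>\<open>convex_on\<close> is for real-valued functions only. Functions into
  \<open>(-\<infinity>, \<infinity>]\<close> are functions into \<^typ>\<open>ereal\<close> that avoid \<open>-\<infinity>\<close>, so every sum
  below is well defined; the convention \<open>0 * \<infinity> = 0\<close> makes the cases \<open>u = 0\<close> and
  \<open>v = 0\<close> trivially true.
\<close>

definition convex_on_ereal :: "'a::real_vector set \<Rightarrow> ('a \<Rightarrow> ereal) \<Rightarrow> bool"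
  where "convex_on_ereal S f \<longleftrightarrow> convex S \<and>
    (\<forall>x\<in>S. \<forall>y\<in>S. \<forall>u\<ge>0. \<forall>v\<ge>0. u + v = 1 \<longrightarrow>
      f (u *\<^sub>R x + v *\<^sub>R y) \<le> ereal u * f x + ereal v * f y)"

definition lower_semicontinuous :: "('a::topological_space \<Rightarrow> 'b::linorder) \<Rightarrow> bool"
  where "lower_semicontinuous f \<longleftrightarrow> (\<forall>x. \<forall>c < f x. \<forall>\<^sub>F y in nhds x. c < f y)"

definition upper_semicontinuous :: "('a::topological_space \<Rightarrow> 'b::linorder) \<Rightarrow> bool"
  where "upper_semicontinuous f \<longleftrightarrow> (\<forall>x. \<forall>c > f x. \<forall>\<^sub>F y in nhds x. f y < c)"

definition extreme_points :: "'a::real_vector set \<Rightarrow> 'a set"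
  where "extreme_points K = {x. x extreme_point_of K}"

end

theory Submission
  imports Defs
begin

text \<open>
  A minimal closed extreme subset of a compact set is a singleton, because the maximisers of an
  upper semicontinuous convex function on it again form a closed extreme subset, and Minkowski
  functionals supply enough such functions to separate points. This gives Bauer's maximum
  principle and, applied to Minkowski functionals once more, shows that an open convex set
  containing the extreme points of \<open>K\<close> contains \<open>K\<close>.

  The latter is used twice. Let \<open>s\<close> be the supremum of \<open>h\<close> over the extreme points,
  without loss of generality finite. The open convex set \<open>{h\<^sub>+ < \<infinity>}\<close> contains the extreme
  points, hence \<open>K\<close>, and on it \<open>h\<^sub>+\<close> is even continuous. If \<open>x \<in> K\<close>, then
  \<open>x\<close> lies in \<open>C + V\<close> for every open convex neighbourhood \<open>V\<close> of \<open>0\<close>, where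
  \<open>C\<close> is the convex hull of the extreme points; as \<open>h \<le> s\<close> on \<open>C\<close> and \<open>h\<close> is lower
  semicontinuous at \<open>x\<close>, it follows that \<open>h x \<le> s\<close>.
\<close>

section \<open>Affine maps and open convex neighbourhoods of 0\<close>

lemma tendsto_scaleR_locally_convex:
  fixes g :: "'b \<Rightarrow> 'a::locally_convex_space"
  assumes "(f \<longlongrightarrow> c) F" "(g \<longlongrightarrow> a) F"
  shows "((\<lambda>x. f x *\<^sub>R g x) \<longlongrightarrow> c *\<^sub>R a) F"
  using filterlim_compose[OF tendsto_scaleR_Pair filterlim_Pair[OF assms]] by simp

lemma open_vimage_affine:
  fixes U :: "'a::locally_convex_space set"
  assumes "open U"
  shows "open ((\<lambda>x. u *\<^sub>R x + a) -` U)"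
proof (rule open_vimage[OF assms])
  show "continuous_on UNIV (\<lambda>x. u *\<^sub>R x + a)"
    unfolding continuous_on_def
    by (intro ballI tendsto_add tendsto_scaleR_locally_convex tendsto_const tendsto_ident_at)
qed

text \<open>For \<open>u\<close> nonzero, the affine map sending \<open>z\<close> to
  \<open>(z - v y) / u\<close> takes \<open>u x + v y\<close> to \<open>x\<close>. The preimage of
  the interior under it is therefore an open neighbourhood of \<open>u x + v y\<close>, and it lies
  in \<open>S\<close> because each of its points is a combination of a point of \<open>S\<close> and
  \<open>y\<close>.\<close>

lemma convex_interior_locally_convex:
  fixes S :: "'a::locally_convex_space set"
  assumes "convex S"
  shows "convex (interior S)"
proof (rule convexI)
  fix x y :: 'a and u v :: real
  assume xy: "x \<in> interior S" "y \<in> interior S" and uv: "0 \<le> u" "0 \<le> v" "u + v = 1"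
  show "u *\<^sub>R x + v *\<^sub>R y \<in> interior S"
  proof (cases "u = 0")
    case True
    then show ?thesis using xy uv by simp
  next
    case False
    define T where "T = (\<lambda>z. inverse u *\<^sub>R z + (- (v / u)) *\<^sub>R y) -` interior S"
    have "open T" unfolding T_def by (rule open_vimage_affine) simp
    moreover have "u *\<^sub>R x + v *\<^sub>R y \<in> T"
      using xy False by (simp add: T_def algebra_simps divide_inverse)
    moreover have "T \<subseteq> S"
    proof
      fix z assume "z \<in> T"
      then have *: "inverse u *\<^sub>R z + (- (v / u)) *\<^sub>R y \<in> S"
        using interior_subset by (auto simp: T_def)
      have "u *\<^sub>R (inverse u *\<^sub>R z + (- (v / u)) *\<^sub>R y) + v *\<^sub>R y \<in> S"
        using convexD[OF assms * _ uv] xy interior_subset by blast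
      moreover have "u *\<^sub>R (inverse u *\<^sub>R z + (- (v / u)) *\<^sub>R y) + v *\<^sub>R y = z"
        using False by (simp add: algebra_simps)
      ultimately show "z \<in> S" by simp
    qed
    ultimately show ?thesis by (meson interiorI)
  qed
qed

lemma open_convex_nhds_zero:
  fixes U :: "'a::locally_convex_space set"
  assumes "open U" "0 \<in> U"
  obtains V where "open V" "convex V" "0 \<in> V" "V \<subseteq> U"
proof -
  obtain V where V: "convex V" "\<forall>\<^sub>F x in nhds 0. x \<in> V" "V \<subseteq> U"
    using convex_nhds_zero[OF assms] by blast
  then have "0 \<in> interior V"
    by (auto simp: eventually_nhds interior_def)
  with V show thesis
    by (meson convex_interior_locally_convex interior_subset open_interior order_trans that)
qed

section \<open>Minkowski functionals of open convex neighbourhoods of 0\<close>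

definition minkowski_functional :: "'a::real_vector set \<Rightarrow> 'a \<Rightarrow> real"
  where "minkowski_functional W x = Inf {t. 0 < t \<and> inverse t *\<^sub>R x \<in> W}"

context
  fixes W :: "'a::locally_convex_space set"
  assumes W: "open W" "convex W" "0 \<in> W"
begin

text \<open>\<open>W\<close> is absorbing, since \<open>x / (n + 1)\<close> tends to 0 by continuity
  of scaling.\<close>

lemma minkowski_set_nonempty: "{t. 0 < t \<and> inverse t *\<^sub>R x \<in> W} \<noteq> {}"
proof -
  have "(\<lambda>n. inverse (real (Suc n)) *\<^sub>R x) \<longlonglongrightarrow> 0 *\<^sub>R x"
    by (intro tendsto_scaleR_locally_convex LIMSEQ_inverse_real_of_nat tendsto_const)
  then have "\<forall>\<^sub>F n in sequentially. inverse (real (Suc n)) *\<^sub>R x \<in> W"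
    using W by (intro topological_tendstoD) auto
  then obtain n where "inverse (real (Suc n)) *\<^sub>R x \<in> W"
    by (meson eventually_sequentially order_refl)
  then show ?thesis by (auto intro!: exI[of _ "real (Suc n)"])
qed

lemma minkowski_bdd_below: "bdd_below {t. 0 < t \<and> inverse t *\<^sub>R x \<in> W}"
  by (rule bdd_belowI[of _ 0]) auto

lemma minkowski_less_iff:
  "minkowski_functional W x < c \<longleftrightarrow> (\<exists>t. 0 < t \<and> t < c \<and> inverse t *\<^sub>R x \<in> W)"
  unfolding minkowski_functional_def
  using cInf_less_iff[OF minkowski_set_nonempty minkowski_bdd_below] by auto

lemma minkowski_le: "0 < t \<Longrightarrow> inverse t *\<^sub>R x \<in> W \<Longrightarrow> minkowski_functional W x \<le> t"
  unfolding minkowski_functional_def by (intro cInf_lower minkowski_bdd_below) simp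

lemma minkowski_nonneg: "0 \<le> minkowski_functional W x"
  using minkowski_less_iff[of x 0] by (meson less_asym not_le)

lemma minkowski_lessD:
  assumes "minkowski_functional W x < t"
  shows "0 < t" "inverse t *\<^sub>R x \<in> W"
proof -
  obtain s where s: "0 < s" "s < t" "inverse s *\<^sub>R x \<in> W"
    using assms minkowski_less_iff by blast
  then show "0 < t" by simp
  \<comment> \<open>The point \<open>x / t\<close> lies on the segment from 0 to
    \<open>x / s\<close>, and \<open>W\<close> is star-shaped about 0.\<close>
  have "(s / t) *\<^sub>R (inverse s *\<^sub>R x) + (1 - s / t) *\<^sub>R 0 \<in> W"
    using s W by (intro convexD) auto
  then show "inverse t *\<^sub>R x \<in> W" using s by (simp add: field_simps)
qed

lemma minkowski_zero: "minkowski_functional W 0 = 0"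
proof (rule antisym[OF _ minkowski_nonneg], rule field_le_epsilon)
  fix e :: real assume "0 < e"
  then show "minkowski_functional W 0 \<le> 0 + e" using W by (simp add: minkowski_le)
qed

text \<open>The strict inequality comes from openness: a point \<open>x\<close> of \<open>W\<close>
  can be stretched by a factor slightly above 1 without leaving \<open>W\<close>.\<close>

lemma minkowski_less_1_iff: "minkowski_functional W x < 1 \<longleftrightarrow> x \<in> W"
proof
  assume "minkowski_functional W x < 1"
  from minkowski_lessD(2)[OF this] show "x \<in> W" by simp
next
  assume x: "x \<in> W"
  have "(\<lambda>n. (1 + inverse (real (Suc n))) *\<^sub>R x) \<longlonglongrightarrow> (1 + 0) *\<^sub>R x"
    by (intro tendsto_scaleR_locally_convex LIMSEQ_inverse_real_of_nat tendsto_const tendsto_add)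
  then have "\<forall>\<^sub>F n in sequentially. (1 + inverse (real (Suc n))) *\<^sub>R x \<in> W"
    by (rule topological_tendstoD) (use W x in auto)
  then obtain n where n: "(1 + inverse (real (Suc n))) *\<^sub>R x \<in> W"
    by (meson eventually_sequentially order_refl)
  define t where "t = 1 + inverse (real (Suc n))"
  have "1 < t" "inverse (inverse t) *\<^sub>R x \<in> W" using n by (simp_all add: t_def)
  then show "minkowski_functional W x < 1"
    unfolding minkowski_less_iff by (auto intro!: exI[of _ "inverse t"] simp: field_simps)
qed

text \<open>Take \<open>s\<close> and \<open>t\<close> slightly above the two values, so that
  \<open>x / s\<close> and \<open>y / t\<close> lie in \<open>W\<close>. With
  \<open>r = u s + v t\<close>, weighting these points by \<open>u s / r\<close> and
  \<open>v t / r\<close> yields \<open>(u x + v y) / r\<close>.\<close>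

lemma minkowski_convex:
  assumes "0 \<le> u" "0 \<le> v" "u + v = 1"
  shows "minkowski_functional W (u *\<^sub>R x + v *\<^sub>R y)
    \<le> u * minkowski_functional W x + v * minkowski_functional W y"
proof (rule field_le_epsilon)
  fix e :: real assume e: "0 < e"
  define s t where "s = minkowski_functional W x + e" and "t = minkowski_functional W y + e"
  have s: "0 < s" "inverse s *\<^sub>R x \<in> W" and t: "0 < t" "inverse t *\<^sub>R y \<in> W"
    using minkowski_lessD[of x s] minkowski_lessD[of y t] e by (simp_all add: s_def t_def)
  define r where "r = u * s + v * t"
  have r: "0 < r"
  proof (cases "u = 0")
    case True
    then show ?thesis using assms t by (simp add: r_def)
  next
    case False
    then show ?thesis using assms s t by (simp add: r_def add_pos_nonneg)
  qed
  have "(u * s / r) *\<^sub>R (inverse s *\<^sub>R x) + (v * t / r) *\<^sub>R (inverse t *\<^sub>R y) \<in> W"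
    using s t assms r W
    by (intro convexD) (auto simp: add_divide_distrib[symmetric], simp add: r_def)
  moreover have "(u * s / r) *\<^sub>R (inverse s *\<^sub>R x) = (u / r) *\<^sub>R x"
    "(v * t / r) *\<^sub>R (inverse t *\<^sub>R y) = (v / r) *\<^sub>R y"
    using s t by simp_all
  ultimately have "(u / r) *\<^sub>R x + (v / r) *\<^sub>R y \<in> W"
    by (simp only:)
  then have "inverse r *\<^sub>R (u *\<^sub>R x + v *\<^sub>R y) \<in> W"
    by (simp add: scaleR_add_right divide_inverse mult.commute)
  then have "minkowski_functional W (u *\<^sub>R x + v *\<^sub>R y) \<le> r"
    using r by (rule minkowski_le[rotated])
  also have "r = u * minkowski_functional W x + v * minkowski_functional W y + (u + v) * e"
    by (simp add: r_def s_def t_def algebra_simps)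
  finally show "minkowski_functional W (u *\<^sub>R x + v *\<^sub>R y)
    \<le> u * minkowski_functional W x + v * minkowski_functional W y + e"
    using assms by simp
qed

lemma minkowski_translate_convex:
  "convex_on UNIV (\<lambda>x. minkowski_functional W (x - a))"
proof (rule convex_onI)
  fix t :: real and x y :: 'a
  assume t: "0 < t" "t < 1"
  have "(1 - t) *\<^sub>R x + t *\<^sub>R y - a = (1 - t) *\<^sub>R (x - a) + t *\<^sub>R (y - a)"
    by (simp add: algebra_simps)
  then show "minkowski_functional W ((1 - t) *\<^sub>R x + t *\<^sub>R y - a)
      \<le> (1 - t) * minkowski_functional W (x - a) + t * minkowski_functional W (y - a)"
    using minkowski_convex[of "1 - t" t] t by simp
qed simp

lemma minkowski_translate_upper_semicontinuous:
  "upper_semicontinuous (\<lambda>x. minkowski_functional W (x - a))"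
  unfolding upper_semicontinuous_def
proof (intro allI impI)
  fix x c assume "minkowski_functional W (x - a) < c"
  then obtain t where t: "0 < t" "t < c" "inverse t *\<^sub>R (x - a) \<in> W"
    using minkowski_less_iff by blast
  let ?T = "(\<lambda>z. inverse t *\<^sub>R z + (- inverse t) *\<^sub>R a) -` W"
  have "open ?T" "x \<in> ?T"
    using t W(1) by (blast intro: open_vimage_affine, simp add: algebra_simps)
  then have "\<forall>\<^sub>F y in nhds x. y \<in> ?T" by (rule eventually_nhds_in_open)
  then show "\<forall>\<^sub>F y in nhds x. minkowski_functional W (y - a) < c"
    by eventually_elim (use t in \<open>auto simp: minkowski_less_iff algebra_simps\<close>)
qed

end

section \<open>Maximisers of upper semicontinuous functions and extreme subsets\<close>

lemma open_upper_semicontinuous_less: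
  assumes "upper_semicontinuous f"
  shows "open {x. f x < c}"
  unfolding open_subopen[of "{x. f x < c}"]
proof
  fix x assume "x \<in> {x. f x < c}"
  then have "\<forall>\<^sub>F y in nhds x. f y < c"
    using assms by (auto simp: upper_semicontinuous_def)
  then show "\<exists>T. open T \<and> x \<in> T \<and> T \<subseteq> {x. f x < c}"
    by (auto simp: eventually_nhds)
qed

text \<open>Without a maximum, the open sets \<open>{z. f z < f y}\<close> with \<open>y\<close> in
  \<open>K\<close> cover \<open>K\<close>. A point of a finite subcover's index set \<open>C\<close>
  with the largest value would then lie below another point of \<open>C\<close>.\<close>

lemma upper_semicontinuous_attains_max:
  fixes f :: "'a::topological_space \<Rightarrow> 'b::linorder"
  assumes "upper_semicontinuous f" "compact K" "K \<noteq> {}"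
  shows "\<exists>x\<in>K. \<forall>y\<in>K. f y \<le> f x"
proof (rule ccontr)
  assume "\<not> ?thesis"
  then have *: "\<exists>y\<in>K. f x < f y" if "x \<in> K" for x
    using that by (meson not_le)
  have "K \<subseteq> (\<Union>y\<in>K. {z. f z < f y})" using * by auto
  then obtain C where C: "C \<subseteq> K" "finite C" "K \<subseteq> (\<Union>y\<in>C. {z. f z < f y})"
    using compactE_image[OF assms(2), of K "\<lambda>y. {z. f z < f y}"]
      open_upper_semicontinuous_less[OF assms(1)] by blast
  then have ne: "C \<noteq> {}" using assms(3) by auto
  then have "Max (f ` C) \<in> f ` C" using C by simp
  then obtain y where y: "y \<in> C" "f y = Max (f ` C)" by auto
  then obtain z where "z \<in> C" "f y < f z" using C by blast
  then show False using y C by (metis Max_ge finite_imageI image_eqI not_le)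
qed

text \<open>Unlike \<^const>\<open>face_of\<close>, no convexity of the subset is required: the set of maximisers
  of a convex function need not be convex.\<close>

definition extreme_subset :: "'a::real_vector set \<Rightarrow> 'a set \<Rightarrow> bool"
  where "extreme_subset F K \<longleftrightarrow> F \<subseteq> K \<and>
    (\<forall>x\<in>F. \<forall>a\<in>K. \<forall>b\<in>K. x \<in> open_segment a b \<longrightarrow> a \<in> F \<and> b \<in> F)"

text \<open>If the value at an inner point of a segment is at least \<open>m\<close> while the end
  values are at most \<open>m\<close>, convexity forces both end values up to
  \<open>m\<close>.\<close>

lemma extreme_subset_maximisers:
  assumes F: "extreme_subset F K" and f: "convex_on UNIV f"
    and m: "\<And>y. y \<in> F \<Longrightarrow> f y \<le> m"
  shows "extreme_subset {x \<in> F. m \<le> f x} K"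
  unfolding extreme_subset_def
proof (intro conjI ballI impI)
  show "{x \<in> F. m \<le> f x} \<subseteq> K" using F unfolding extreme_subset_def by blast
next
  fix x a b
  assume x: "x \<in> {x \<in> F. m \<le> f x}" and ab: "a \<in> K" "b \<in> K" "x \<in> open_segment a b"
  then have F': "a \<in> F" "b \<in> F" using F unfolding extreme_subset_def by blast+
  obtain u where u: "0 < u" "u < 1" "x = (1 - u) *\<^sub>R a + u *\<^sub>R b"
    using ab by (auto simp: in_segment)
  have "m \<le> (1 - u) * f a + u * f b"
    using x u convex_onD[OF f, of u a b] by auto
  moreover have "(1 - u) * f a \<le> (1 - u) * m" "u * f b \<le> u * m"
    using u m F' by (auto intro!: mult_left_mono)
  ultimately have "(1 - u) * m \<le> (1 - u) * f a" "u * m \<le> u * f b"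
    by (simp_all add: algebra_simps)
  then have "m \<le> f a" "m \<le> f b" using u by simp_all
  then show "a \<in> {x \<in> F. m \<le> f x}" "b \<in> {x \<in> F. m \<le> f x}" using F' by auto
qed

text \<open>The Minkowski functional of a neighbourhood of 0 that misses \<open>b - a\<close>,
  translated by \<open>a\<close>, vanishes at \<open>a\<close> and is at least 1 at
  \<open>b\<close>.\<close>

lemma separating_convex_function:
  fixes a b :: "'a::locally_convex_space"
  assumes "a \<noteq> b"
  obtains f :: "'a \<Rightarrow> real" where "convex_on UNIV f" "upper_semicontinuous f" "f a < f b"
proof -
  have "open (- {b - a})" "0 \<in> - {b - a}" using assms by auto
  then obtain V where V: "open V" "convex V" "0 \<in> V" "V \<subseteq> - {b - a}"
    by (rule open_convex_nhds_zero)
  show thesis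
  proof (rule that)
    show "convex_on UNIV (\<lambda>x. minkowski_functional V (x - a))"
      "upper_semicontinuous (\<lambda>x. minkowski_functional V (x - a))"
      using V minkowski_translate_convex minkowski_translate_upper_semicontinuous by blast+
    have "\<not> minkowski_functional V (b - a) < 1"
      using V minkowski_less_1_iff[of V "b - a"] by auto
    then show "minkowski_functional V (a - a) < minkowski_functional V (b - a)"
      using minkowski_zero[of V] V by simp
  qed
qed

text \<open>The closed extreme subsets are represented by their open complements \<open>U\<close>, so that
  minimal subsets become maximal elements for Zorn's lemma.\<close>

lemma extreme_point_in_extreme_subset:
  fixes K :: "'a::locally_convex_space set"
  assumes K: "compact K" and U0: "open U0" "K - U0 \<noteq> {}" "extreme_subset (K - U0) K"
  obtains e where "e \<in> extreme_points K" "e \<in> K - U0"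
proof -
  define A where "A = {U. open U \<and> U0 \<subseteq> U \<and> K - U \<noteq> {} \<and> extreme_subset (K - U) K}"
  have "U0 \<in> A" using U0 by (simp add: A_def)
  have "\<exists>M\<in>A. \<forall>X\<in>A. M \<subseteq> X \<longrightarrow> X = M"
  proof (rule subset_Zorn_nonempty)
    show "A \<noteq> {}" using \<open>U0 \<in> A\<close> by blast
  next
    fix C assume C: "C \<noteq> {}" "subset.chain A C"
    then have CA: "C \<subseteq> A" by (simp add: subset_chain_def)
    \<comment> \<open>If the chain covered \<open>K\<close>, so would a finite part of it, and hence
      its largest member alone.\<close>
    have "K - \<Union>C \<noteq> {}"
    proof
      assume "K - \<Union>C = {}"
      then obtain D where D: "D \<subseteq> C" "finite D" "K \<subseteq> \<Union>D"
        using compactE[OF K, of C] CA by (auto simp: A_def)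
      have "D \<noteq> {}" using D(3) U0(2) by auto
      moreover have "subset.chain A D" using C D by (meson subset_chain_def subsetD subset_trans)
      ultimately have "\<Union>D \<in> D" using D(2) by (intro Union_in_chain)
      then show False using D CA by (auto simp: A_def)
    qed
    moreover have "extreme_subset (K - \<Union>C) K"
      using CA unfolding extreme_subset_def A_def by (clarsimp, blast)
    ultimately show "\<Union>C \<in> A"
      using CA C by (auto simp: A_def)
  qed
  then obtain M where M: "M \<in> A" and max: "\<And>X. X \<in> A \<Longrightarrow> M \<subseteq> X \<Longrightarrow> X = M" by blast
  \<comment> \<open>By maximality of \<open>M\<close>, such an \<open>f\<close> is constant on
    \<open>K - M\<close>: otherwise adjoining all points below its maximum would give a strictly
    larger element of \<open>A\<close>. Separation of points then leaves a single point.\<close>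
  have const: "\<not> f a < f b"
    if f: "convex_on UNIV f" "upper_semicontinuous f" and ab: "a \<in> K - M" "b \<in> K - M"
    for f :: "'a \<Rightarrow> real" and a b
  proof
    assume less: "f a < f b"
    have "compact (K - M)" using K M by (auto simp: A_def intro: compact_diff)
    then obtain x where x: "x \<in> K - M" "\<And>y. y \<in> K - M \<Longrightarrow> f y \<le> f x"
      using upper_semicontinuous_attains_max[OF f(2), of "K - M"] ab(1) by (metis empty_iff)
    let ?X = "M \<union> {y. f y < f x}"
    have eq: "K - ?X = {y \<in> K - M. f x \<le> f y}" by auto
    have "?X \<in> A"
      using extreme_subset_maximisers[of "K - M" K f "f x"] x f M
        open_upper_semicontinuous_less[OF f(2)]
      unfolding A_def mem_Collect_eq eq by auto
    then have "?X = M" using max by blast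
    moreover have "a \<in> ?X" using less x(2)[OF ab(2)] by simp
    ultimately show False using ab(1) by blast
  qed
  obtain e where e: "e \<in> K - M" using M by (auto simp: A_def)
  have single: "z = e" if "z \<in> K - M" for z
    using const that e separating_convex_function by metis
  have "e extreme_point_of K"
    unfolding extreme_point_of_def
  proof (intro conjI ballI notI)
    fix a b assume ab: "a \<in> K" "b \<in> K" "e \<in> open_segment a b"
    then have "a \<in> K - M" "b \<in> K - M"
      using M e unfolding A_def extreme_subset_def by blast+
    then have "a = e" "b = e" using single by auto
    then show False using ab by simp
  qed (use e in auto)
  then show thesis using that[of e] e M by (auto simp: extreme_points_def A_def)
qed

section \<open>Bauer's maximum principle and its consequence for open convex sets\<close>

lemma extreme_points_nonempty:
  fixes K :: "'a::locally_convex_space set"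
  assumes "compact K" "K \<noteq> {}"
  shows "extreme_points K \<noteq> {}"
  using extreme_point_in_extreme_subset[OF assms(1), of "{}"] assms(2)
  by (auto simp: extreme_subset_def)

lemma bauer_maximum_principle:
  fixes K :: "'a::locally_convex_space set" and f :: "'a \<Rightarrow> real"
  assumes K: "compact K" "K \<noteq> {}" and f: "convex_on UNIV f" "upper_semicontinuous f"
  obtains e where "e \<in> extreme_points K" "\<And>x. x \<in> K \<Longrightarrow> f x \<le> f e"
proof -
  obtain x where x: "x \<in> K" "\<And>y. y \<in> K \<Longrightarrow> f y \<le> f x"
    using upper_semicontinuous_attains_max[OF f(2) K] by blast
  have eq: "K - {y. f y < f x} = {y \<in> K. f x \<le> f y}" by auto
  have "extreme_subset (K - {y. f y < f x}) K"
    unfolding eq using x f by (intro extreme_subset_maximisers) (auto simp: extreme_subset_def)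
  then obtain e where e: "e \<in> extreme_points K" "e \<in> K - {y. f y < f x}"
    using extreme_point_in_extreme_subset[OF K(1) open_upper_semicontinuous_less[OF f(2)]] x
    by blast
  show thesis
    by (rule that[OF e(1)]) (use e x in force)
qed

text \<open>This takes the place of the Krein--Milman theorem and, with it, of Hahn--Banach
  separation.\<close>

lemma subset_open_convex_if_extreme_points_subset:
  fixes K W :: "'a::locally_convex_space set"
  assumes K: "compact K" and W: "open W" "convex W" and sub: "extreme_points K \<subseteq> W"
  shows "K \<subseteq> W"
proof
  fix x assume x: "x \<in> K"
  then have "K \<noteq> {}" by auto
  then obtain a where a: "a \<in> W" using extreme_points_nonempty[OF K] sub by blast
  \<comment> \<open>Translating by a point of \<open>W\<close> puts 0 into the set, as Minkowski
    functionals require.\<close>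
  define V where "V = (\<lambda>z. 1 *\<^sub>R z + a) -` W"
  have mem: "z - a \<in> V \<longleftrightarrow> z \<in> W" for z by (simp add: V_def)
  have V: "open V" "0 \<in> V" using a W(1) unfolding V_def by (blast intro: open_vimage_affine, simp)
  have "convex V"
  proof (rule convexI)
    fix y z :: 'a and u v :: real
    assume "y \<in> V" "z \<in> V" and uv: "0 \<le> u" "0 \<le> v" "u + v = 1"
    then have "u *\<^sub>R (y + a) + v *\<^sub>R (z + a) \<in> W"
      using convexD[OF W(2) _ _ uv] by (simp add: V_def)
    moreover have "u *\<^sub>R (y + a) + v *\<^sub>R (z + a) = u *\<^sub>R y + v *\<^sub>R z + (u + v) *\<^sub>R a"
      by (simp add: algebra_simps)
    ultimately show "u *\<^sub>R y + v *\<^sub>R z \<in> V" using uv by (simp add: V_def)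
  qed
  note V = V(1) this V(2)
  obtain e where "e \<in> extreme_points K"
    and e: "minkowski_functional V (x - a) \<le> minkowski_functional V (e - a)"
    using bauer_maximum_principle[OF K \<open>K \<noteq> {}\<close> minkowski_translate_convex[OF V, of a]
        minkowski_translate_upper_semicontinuous[OF V, of a]] x by metis
  then have "minkowski_functional V (e - a) < 1"
    using sub by (auto simp: minkowski_less_1_iff[OF V] mem)
  with e have "minkowski_functional V (x - a) < 1" by simp
  then show "x \<in> W" by (simp add: minkowski_less_1_iff[OF V] mem)
qed

section \<open>Convex functions with extended real values\<close>

lemma convex_on_erealD:
  assumes "convex_on_ereal S f" "x \<in> S" "y \<in> S" "0 \<le> u" "0 \<le> v" "u + v = 1"
  shows "f (u *\<^sub>R x + v *\<^sub>R y) \<le> ereal u * f x + ereal v * f y"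
  using assms by (auto simp: convex_on_ereal_def)

lemma convex_on_ereal_add:
  assumes f: "convex_on_ereal S f" and g: "convex_on_ereal S g"
    and "\<And>x. f x \<noteq> -\<infinity>" "\<And>x. g x \<noteq> -\<infinity>"
  shows "convex_on_ereal S (\<lambda>x. f x + g x)"
  unfolding convex_on_ereal_def
proof (intro conjI ballI allI impI)
  show "convex S" using f by (simp add: convex_on_ereal_def)
next
  fix x y u v assume *: "x \<in> S" "y \<in> S" "0 \<le> u" "0 \<le> v" "u + v = (1::real)"
  have "f (u *\<^sub>R x + v *\<^sub>R y) + g (u *\<^sub>R x + v *\<^sub>R y)
      \<le> (ereal u * f x + ereal v * f y) + (ereal u * g x + ereal v * g y)"
    using * f g by (intro add_mono convex_on_erealD)
  also have "\<dots> = ereal u * (f x + g x) + ereal v * (f y + g y)"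
    using assms(3,4) *(3,4)
    by (simp add: ereal_pos_distrib ac_simps)
  finally show "f (u *\<^sub>R x + v *\<^sub>R y) + g (u *\<^sub>R x + v *\<^sub>R y)
      \<le> ereal u * (f x + g x) + ereal v * (f y + g y)" .
qed

lemma convex_ereal_sublevel:
  assumes "convex_on_ereal UNIV f"
  shows "convex {x. f x \<le> ereal c}"
proof (rule convexI)
  fix x y :: 'a and u v :: real
  assume *: "x \<in> {x. f x \<le> ereal c}" "y \<in> {x. f x \<le> ereal c}" "0 \<le> u" "0 \<le> v" "u + v = 1"
  then have "f (u *\<^sub>R x + v *\<^sub>R y) \<le> ereal u * f x + ereal v * f y"
    by (intro convex_on_erealD[OF assms]) auto
  also have "\<dots> \<le> ereal u * ereal c + ereal v * ereal c"
    using * by (intro add_mono ereal_mult_left_mono) auto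
  also have "\<dots> = ereal ((u + v) * c)" by (simp add: algebra_simps)
  finally show "u *\<^sub>R x + v *\<^sub>R y \<in> {x. f x \<le> ereal c}" using * by simp
qed

lemma convex_ereal_domain:
  assumes f: "convex_on_ereal UNIV f"
  shows "convex {x. f x < \<infinity>}"
proof (rule convexI)
  fix x y :: 'a and u v :: real
  assume *: "x \<in> {x. f x < \<infinity>}" "y \<in> {x. f x < \<infinity>}" "0 \<le> u" "0 \<le> v" "u + v = 1"
  then have "f (u *\<^sub>R x + v *\<^sub>R y) \<le> ereal u * f x + ereal v * f y"
    by (intro convex_on_erealD[OF f]) auto
  also have "\<dots> < \<infinity>"
    using * by (cases "f x"; cases "f y"; cases "u = 0"; cases "v = 0") auto
  finally show "u *\<^sub>R x + v *\<^sub>R y \<in> {x. f x < \<infinity>}" by simp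
qed

text \<open>Reflecting at \<open>x\<close> turns the upper bound into a lower one:
  \<open>2 f x \<le> f y + f (2 x - y)\<close>.\<close>

lemma upper_semicontinuous_convex_lower_bound:
  fixes f :: "'a::locally_convex_space \<Rightarrow> ereal"
  assumes f: "convex_on_ereal UNIV f" "upper_semicontinuous f"
    and x: "f x = ereal r" and c: "c < r"
  shows "\<forall>\<^sub>F y in nhds x. ereal c < f y"
proof -
  define U where "U = {y. f y < ereal (2 * r - c)}"
  have "open U" unfolding U_def by (rule open_upper_semicontinuous_less[OF f(2)])
  then have "open ((\<lambda>y. (-1) *\<^sub>R y + 2 *\<^sub>R x) -` U)" by (rule open_vimage_affine)
  moreover have "x \<in> (\<lambda>y. (-1) *\<^sub>R y + 2 *\<^sub>R x) -` U"
    using x c by (simp add: U_def scaleR_2)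
  ultimately have "\<forall>\<^sub>F y in nhds x. y \<in> (\<lambda>y. (-1) *\<^sub>R y + 2 *\<^sub>R x) -` U"
    by (rule eventually_nhds_in_open)
  then show ?thesis
  proof eventually_elim
    case (elim y)
    define z where "z = 2 *\<^sub>R x - y"
    have z: "f z < ereal (2 * r - c)" using elim by (simp add: U_def z_def)
    have "x = (1/2) *\<^sub>R y + (1/2) *\<^sub>R z" by (simp add: z_def algebra_simps)
    then have "ereal r \<le> ereal (1/2) * f y + ereal (1/2) * f z"
      using convex_on_erealD[OF f(1), of y z "1/2" "1/2"] x by simp
    then show "ereal c < f y"
      using z by (cases "f y"; cases "f z") auto
  qed
qed

theorem lemma3p4:
  fixes h_minus h_plus h :: "'a::locally_convex_space \<Rightarrow> ereal"
    and K :: "'a set"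
  assumes "\<And>x. h_minus x \<noteq> -\<infinity>" and "\<And>x. h_plus x \<noteq> -\<infinity>"
    and "convex_on_ereal UNIV h_minus" and "convex_on_ereal UNIV h_plus"
    and "lower_semicontinuous h_minus" and "upper_semicontinuous h_plus"
    and "h = (\<lambda>x. h_minus x + h_plus x)"
    and "K \<noteq> {}" and "compact K" and "convex K"
  shows "extreme_points K \<noteq> {} \<and> (SUP x\<in>K. h x) = (SUP x\<in>extreme_points K. h x)"
proof
  let ?E = "extreme_points K"
  define S where "S = (SUP x\<in>?E. h x)"
  show ne: "?E \<noteq> {}" using extreme_points_nonempty assms(8,9) by blast
  have EK: "?E \<subseteq> K" by (auto simp: extreme_points_def extreme_point_of_def)
  have hS: "h e \<le> S" if "e \<in> ?E" for e unfolding S_def using that by (rule SUP_upper)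
  have h_conv: "convex_on_ereal UNIV h"
    unfolding assms(7) using assms(1-4) by (intro convex_on_ereal_add)
  have "h x \<le> S" if x: "x \<in> K" for x
  proof (cases S)
    case PInf
    then show ?thesis by simp
  next
    case MInf
    then show ?thesis using ne hS assms(1,2,7) by force
  next
    case (real s)
    have "?E \<subseteq> {x. h_plus x < \<infinity>}"
    proof
      fix e assume "e \<in> ?E"
      then have "h e \<noteq> \<infinity>" using hS real by force
      then show "e \<in> {x. h_plus x < \<infinity>}" using assms(7) by auto
    qed
    then have "K \<subseteq> {x. h_plus x < \<infinity>}"
      by (rule subset_open_convex_if_extreme_points_subset[OF assms(9)
          open_upper_semicontinuous_less[OF assms(6)] convex_ereal_domain[OF assms(4)]])
    then obtain r where r: "h_plus x = ereal r"
      using x assms(2)[of x] by (cases "h_plus x") auto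
    have hull: "h y \<le> ereal s" if "y \<in> convex hull ?E" for y
    proof -
      have "convex hull ?E \<subseteq> {x. h x \<le> ereal s}"
        using hS real by (intro hull_minimal convex_ereal_sublevel h_conv) auto
      then show ?thesis using that by auto
    qed
    \<comment> \<open>This is lower semicontinuity of \<open>h\<close> at \<open>x\<close>, split
      over the summands: near \<open>x\<close> the value of \<open>h\<close> is at least
      \<open>p + q\<close>, and a point of the hull, where \<open>h\<close> is at most
      \<open>s\<close>, is found there.\<close>
    have approx: "p + q \<le> s" if p: "ereal p < h_minus x" and q: "q < r" for p q
    proof -
      have "\<forall>\<^sub>F y in nhds x. ereal p < h_minus y \<and> ereal q < h_plus y"
        using p assms(5) upper_semicontinuous_convex_lower_bound[OF assms(4,6) r q]
        by (auto simp: lower_semicontinuous_def intro: eventually_conj)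
      then obtain N where N: "open N" "x \<in> N"
        "\<And>y. y \<in> N \<Longrightarrow> ereal p < h_minus y \<and> ereal q < h_plus y"
        by (auto simp: eventually_nhds)
      \<comment> \<open>The reflection makes \<open>x - v\<close> lie in \<open>N\<close> for all
        \<open>v\<close> in \<open>V\<close>; thus \<open>x = y + v\<close> will put the hull point
        \<open>y\<close> into \<open>N\<close>.\<close>
      have "open ((\<lambda>v. (-1) *\<^sub>R v + x) -` N)" "0 \<in> (\<lambda>v. (-1) *\<^sub>R v + x) -` N"
        using N by (blast intro: open_vimage_affine, simp)
      then obtain V where V: "open V" "convex V" "0 \<in> V"
        "V \<subseteq> (\<lambda>v. (-1) *\<^sub>R v + x) -` N"
        by (rule open_convex_nhds_zero)
      define W where "W = (\<Union>y\<in>convex hull ?E. \<Union>v\<in>V. {y + v})"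
      have "W = (\<Union>y\<in>convex hull ?E. (\<lambda>z. 1 *\<^sub>R z + (- y)) -` V)"
        unfolding W_def by (force simp: algebra_simps)
      then have "open W" using V(1) by (simp only:) (intro open_UN ballI open_vimage_affine)
      moreover have "convex W"
        unfolding W_def by (intro convex_sums convex_convex_hull V)
      moreover have "?E \<subseteq> W"
        unfolding W_def using V(3) hull_subset[of ?E convex] by force
      ultimately have "K \<subseteq> W"
        by (rule subset_open_convex_if_extreme_points_subset[OF assms(9)])
      then obtain y v where yv: "y \<in> convex hull ?E" "v \<in> V" "x = y + v"
        using x unfolding W_def by auto
      then have "y \<in> N" using V(4) by auto
      then have "ereal p + ereal q \<le> h y"
        unfolding assms(7) using N(3) by (intro add_mono) (auto intro: less_imp_le)
      also have "h y \<le> ereal s" by (rule hull[OF yv(1)])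
      finally show ?thesis by simp
    qed
    \<comment> \<open>Bounding \<open>h_minus x\<close> by a real number also excludes the value
      infinity.\<close>
    have "h_minus x \<le> ereal (s - r)"
    proof (rule ccontr)
      assume "\<not> ?thesis"
      then obtain p where p: "ereal (s - r) < ereal p" "ereal p < h_minus x"
        by (metis ereal_dense2 not_le)
      \<comment> \<open>Since \<open>s - p < r\<close>, the midpoint \<open>q\<close> of
        \<open>s - p\<close> and \<open>r\<close> satisfies both \<open>q < r\<close> and
        \<open>p + q > s\<close>.\<close>
      show False using approx[OF p(2), of "(r + s - p) / 2"] p(1) by (auto simp: field_simps)
    qed
    then show ?thesis using real r assms(7) by (cases "h_minus x") auto
  qed
  then have "(SUP x\<in>K. h x) \<le> S" by (rule SUP_least)
  moreover have "S \<le> (SUP x\<in>K. h x)" unfolding S_def by (rule SUP_subset_mono[OF EK]) simp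
  ultimately show "(SUP x\<in>K. h x) = (SUP x\<in>?E. h x)" unfolding S_def by (rule antisym)
qed

end
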